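(* Let $p$ be a prime and $G$ a finite $p$-group of exponent $p$ in which every non-abelian subgroup $H$ satisfies $C_G(H)\le H$. If $|G|>p^p$, then $G$ is elementary abelian. Otherwise, either $G$ is elementary abelian, or $G$ has maximal class and has an elementary abelian subgroup of index $p$.
   Context: A group of order $p^n$ ($n\ge 2$) has maximal class if its nilpotency class is $n-1$. $C_G(H)$ denotes the centralizer of $H$ in $G$. *)

theory Defs
  imports "HOL-Algebra.Algebra"
begin

definition centralizer :: "('a, 'b) monoid_scheme \<Rightarrow> 'a set \<Rightarrow> 'a set" where
  "centralizer G H = {g \<in> carrier G. \<forall>h \<in> H. g \<otimes>\<^bsub>G\<^esub> h = h \<otimes>\<^bsub>G\<^esub> g}"

definition commutator_subgroup :: "('a, 'b) monoid_scheme \<Rightarrow> 'a set \<Rightarrow> 'a set \<Rightarrow> 'a set" where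
  "commutator_subgroup G H K = generate G
     (\<Union>h \<in> H. \<Union>k \<in> K. {h \<otimes>\<^bsub>G\<^esub> k \<otimes>\<^bsub>G\<^esub> inv\<^bsub>G\<^esub> h \<otimes>\<^bsub>G\<^esub> inv\<^bsub>G\<^esub> k})"

text \<open>Lower central series: lcs G 0 = G = gamma_1, lcs G (Suc i) = [lcs G i, G], so lcs G i = gamma_(i+1).\<close>
fun lower_central :: "('a, 'b) monoid_scheme \<Rightarrow> nat \<Rightarrow> 'a set" where
  "lower_central G 0 = carrier G"
| "lower_central G (Suc i) = commutator_subgroup G (lower_central G i) (carrier G)"

definition nilpotent_group :: "('a, 'b) monoid_scheme \<Rightarrow> bool" where
  "nilpotent_group G \<longleftrightarrow> group G \<and> (\<exists>c. lower_central G c = {\<one>\<^bsub>G\<^esub>})"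

definition nilpotency_class :: "('a, 'b) monoid_scheme \<Rightarrow> nat" where
  "nilpotency_class G = (LEAST c. lower_central G c = {\<one>\<^bsub>G\<^esub>})"

definition maximal_class :: "nat \<Rightarrow> ('a, 'b) monoid_scheme \<Rightarrow> bool" where
  "maximal_class p G \<longleftrightarrow> (\<exists>n. n \<ge> 2 \<and> order G = p ^ n \<and> nilpotent_group G
                              \<and> nilpotency_class G = n - 1)"

definition elementary_abelian :: "nat \<Rightarrow> ('a, 'b) monoid_scheme \<Rightarrow> bool" where
  "elementary_abelian p G \<longleftrightarrow> comm_group G \<and> (\<forall>x \<in> carrier G. x [^]\<^bsub>G\<^esub> p = \<one>\<^bsub>G\<^esub>)"

definition has_exponent :: "('a, 'b) monoid_scheme \<Rightarrow> nat \<Rightarrow> bool" where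
  "has_exponent G e \<longleftrightarrow> e > 0 \<and> (\<forall>x \<in> carrier G. x [^]\<^bsub>G\<^esub> e = \<one>\<^bsub>G\<^esub>)
     \<and> (\<forall>d. 0 < d \<longrightarrow> (\<forall>x \<in> carrier G. x [^]\<^bsub>G\<^esub> d = \<one>\<^bsub>G\<^esub>) \<longrightarrow> e dvd d)"

end

theory Submission
  imports Defs
begin

text \<open>
  Suppose \<open>G\<close> is not abelian and pick a non-central \<open>y\<close> that is central modulo \<open>Z(G)\<close>. If
  \<open>x\<close> does not commute with \<open>y\<close>, then \<open>\<langle>x, y\<rangle>\<close> is non-abelian of order \<open>p\<^sup>3\<close> with centre of
  order \<open>p\<close>, and it contains its centralizer, hence \<open>Z(G)\<close>; so \<open>|Z(G)| = p\<close>. The same holds for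
  every non-abelian subgroup. Now \<open>A = C\<^sub>G(y)\<close> has index \<open>p\<close>, being the kernel of the homomorphism
  \<open>g \<mapsto> [g, y]\<close> into \<open>Z(G)\<close>, and its centre contains both \<open>Z(G)\<close> and \<open>y\<close>, so \<open>A\<close> is abelian.

  For \<open>x \<notin> A\<close> the endomorphism \<open>T a = [a, x]\<close> of \<open>A\<close> has kernel \<open>Z(G)\<close>, and the exponent condition
  \<open>(a x)\<^sup>p = 1\<close> says \<open>T\<^sup>p\<^sup>-\<^sup>1 = 1\<close>. Hence each image \<open>T\<^sup>i(A)\<close> has index \<open>p\<close> in the preceding one until
  the trivial group is reached, which bounds \<open>|A|\<close> by \<open>p\<^sup>p\<^sup>-\<^sup>1\<close>. Since the \<open>T\<^sup>i(A)\<close> with \<open>i \<ge> 1\<close> are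
  the terms of the lower central series, \<open>G\<close> has maximal class.
\<close>

section \<open>Centralizers and p-groups\<close>

lemma centralizerD:
  "a \<in> centralizer G K \<Longrightarrow> h \<in> K \<Longrightarrow> a \<otimes>\<^bsub>G\<^esub> h = h \<otimes>\<^bsub>G\<^esub> a"
  by (simp add: centralizer_def)

lemma centralizer_carrier: "a \<in> centralizer G K \<Longrightarrow> a \<in> carrier G"
  by (simp add: centralizer_def)

lemma centralizerI:
  "a \<in> carrier G \<Longrightarrow> (\<And>h. h \<in> K \<Longrightarrow> a \<otimes>\<^bsub>G\<^esub> h = h \<otimes>\<^bsub>G\<^esub> a) \<Longrightarrow> a \<in> centralizer G K"
  by (simp add: centralizer_def)

lemma centralizer_carrier_update:
  assumes "A \<subseteq> carrier G"
  shows "centralizer (G\<lparr>carrier := A\<rparr>) K = A \<inter> centralizer G K"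
  unfolding centralizer_def using assms by auto

context group
begin

section \<open>Word identities for commutators and conjugates\<close>

lemma mult_inv_cancel_left:
  assumes "a \<in> carrier G" "b \<in> carrier G"
  shows "a \<otimes> (inv a \<otimes> b) = b" "inv a \<otimes> (a \<otimes> b) = b"
  using assms by (simp_all flip: m_assoc)

text \<open>Together these rules normalize words in a group: inverses move to the letters, products
  associate to the right, and adjacent inverse letters cancel even inside a longer word.\<close>

lemmas group_word_simps = m_assoc inv_mult_group mult_inv_cancel_left

lemma inv_commutator:
  assumes "g \<in> carrier G" "h \<in> carrier G"
  shows "inv (g \<otimes> h \<otimes> inv g \<otimes> inv h) = h \<otimes> g \<otimes> inv h \<otimes> inv g"
  using assms by (simp add: group_word_simps)

lemma conj_eq_inv_commutator_mult:
  assumes "g \<in> carrier G" "h \<in> carrier G"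
  shows "h \<otimes> g \<otimes> inv h = inv (g \<otimes> h \<otimes> inv g \<otimes> inv h) \<otimes> g"
  using assms by (simp add: group_word_simps)

lemma conj_mult:
  assumes "g \<in> carrier G" "h \<in> carrier G" "n \<in> carrier G"
  shows "g \<otimes> h \<otimes> n \<otimes> inv (g \<otimes> h) = g \<otimes> (h \<otimes> n \<otimes> inv h) \<otimes> inv g"
  using assms by (simp add: group_word_simps)

lemma commutator_mult_right:
  assumes "b \<in> carrier G" "g \<in> carrier G" "h \<in> carrier G"
  shows "b \<otimes> (g \<otimes> h) \<otimes> inv b \<otimes> inv (g \<otimes> h)
        = (b \<otimes> g \<otimes> inv b \<otimes> inv g) \<otimes> (g \<otimes> (b \<otimes> h \<otimes> inv b \<otimes> inv h) \<otimes> inv g)"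
  using assms by (simp add: group_word_simps)

lemma commutator_mult_left:
  assumes "g \<in> carrier G" "k \<in> carrier G" "h \<in> carrier G"
  shows "(g \<otimes> k) \<otimes> h \<otimes> inv (g \<otimes> k) \<otimes> inv h
        = (g \<otimes> (k \<otimes> h \<otimes> inv k \<otimes> inv h) \<otimes> inv g) \<otimes> (g \<otimes> h \<otimes> inv g \<otimes> inv h)"
  using assms by (simp add: group_word_simps)

lemma commutator_eq_one:
  assumes "g \<in> carrier G" "h \<in> carrier G" "g \<otimes> h = h \<otimes> g"
  shows "g \<otimes> h \<otimes> inv g \<otimes> inv h = \<one>"
  unfolding assms(3) using assms(1,2) by (simp add: m_assoc)

lemma conj_eq_self:
  assumes "g \<in> carrier G" "h \<in> carrier G" "g \<otimes> h = h \<otimes> g"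
  shows "g \<otimes> h \<otimes> inv g = h"
  unfolding assms(3) using assms(1,2) by (simp add: m_assoc)

lemma inv_commute:
  assumes "a \<in> carrier G" "h \<in> carrier G" "a \<otimes> h = h \<otimes> a"
  shows "inv a \<otimes> h = h \<otimes> inv a"
proof -
  have "inv a \<otimes> h = inv a \<otimes> (h \<otimes> a) \<otimes> inv a"
    using assms(1,2) by (simp add: m_assoc)
  also have "\<dots> = h \<otimes> inv a"
    using assms(1,2) by (simp add: mult_inv_cancel_left flip: assms(3))
  finally show ?thesis .
qed

text \<open>Inverses come for free in a finite group, since \<open>a [^] (order G - 1)\<close>
  inverts \<open>a\<close>.\<close>

lemma subgroup_if_finite_closed:
  assumes "finite (carrier G)" "S \<subseteq> carrier G" "\<one> \<in> S"
    and closed: "\<And>a b. a \<in> S \<Longrightarrow> b \<in> S \<Longrightarrow> a \<otimes> b \<in> S"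
  shows "subgroup S G"
proof (rule subgroupI)
  fix a assume a: "a \<in> S"
  then have aG: "a \<in> carrier G" using assms(2) by blast
  have pow: "a [^] k \<in> S" for k :: nat
    by (induction k) (use a assms(3) closed in auto)
  have "order G \<noteq> 0"
    using assms(1) order_gt_0_iff_finite by auto
  then obtain m where "order G = Suc m"
    using not0_implies_Suc by blast
  then have "a [^] m \<otimes> a = \<one>"
    using pow_order_eq_1[OF aG] by simp
  then have "inv a = a [^] m"
    using aG by (simp add: inv_equality)
  then show "inv a \<in> S" using pow by simp
qed (use assms in auto)

lemma card_subgroup_dvd:
  assumes "subgroup H G"
  shows "card H dvd order G"
  using lagrange[OF assms] by (metis dvd_triv_right)

lemma subgroup_centralizer:
  assumes "K \<subseteq> carrier G"
  shows "subgroup (centralizer G K) G"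
proof (rule subgroupI)
  have "\<one> \<in> centralizer G K" using assms by (auto simp: centralizer_def)
  then show "centralizer G K \<noteq> {}" by blast
next
  fix a b assume ab: "a \<in> centralizer G K" "b \<in> centralizer G K"
  show "a \<otimes> b \<in> centralizer G K"
    using ab assms by (auto simp: centralizer_def subset_iff) (metis m_assoc)
next
  fix a assume a: "a \<in> centralizer G K"
  show "inv a \<in> centralizer G K"
    using a assms by (auto simp: centralizer_def subset_iff inv_commute)
qed (auto simp: centralizer_def)

lemma normal_center: "centralizer G (carrier G) \<lhd> G"
proof -
  have "x \<otimes> h \<otimes> inv x = h" if "x \<in> carrier G" "h \<in> centralizer G (carrier G)" for x h
    using that centralizerD[OF that(2,1)] by (auto intro: centralizer_carrier conj_eq_self)
  then show ?thesis by (simp add: normal_inv_iff subgroup_centralizer)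
qed

text \<open>Class equation: conjugation orbits have p-power length, and an orbit of length 1 is a
  central element. If only the identity were central, all other lengths would be divisible by
  \<open>p\<close>, and so would 1.\<close>

lemma nontrivial_center:
  assumes p: "Factorial_Ring.prime p" and n: "order G = p ^ n" and nt: "carrier G \<noteq> {\<one>}"
  shows "\<exists>z \<in> centralizer G (carrier G). z \<noteq> \<one>"
proof (rule ccontr)
  assume H: "\<not> ?thesis"
  let ?\<phi> = "\<lambda>g. \<lambda>h \<in> carrier G. g \<otimes> h \<otimes> inv g"
  interpret group_action G "carrier G" ?\<phi> by (rule action_by_conjugation)
  have "order G > 0" using n p by (simp add: prime_gt_0_nat)
  then have fin: "finite (carrier G)" using order_gt_0_iff_finite by auto
  let ?O = "orbits G (carrier G) ?\<phi>"
  have finO: "finite ?O" by (auto simp: orbits_def fin)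
  have one: "orbit G ?\<phi> \<one> = {\<one>}"
    using orbit_refl[of \<one>] by (auto simp: orbit_def)
  have dvd: "p dvd card orb" if orb: "orb \<in> ?O - {{\<one>}}" for orb
  proof -
    from orb obtain x where x: "x \<in> carrier G" "orb = orbit G ?\<phi> x"
      by (auto simp: orbits_def)
    have "card orb dvd p ^ n"
      unfolding x(2) n[symmetric] orbit_stabilizer_theorem[OF x(1), symmetric]
      by (rule dvd_triv_left)
    then obtain i where i: "card orb = p ^ i"
      using divides_primepow_nat[OF p] by blast
    have "i \<noteq> 0"
    proof
      assume "i = 0"
      then have "card orb = 1" using i by simp
      moreover have xo: "x \<in> orb" using orbit_refl x by simp
      ultimately have "orb = {x}" by (auto simp: card_1_singleton_iff)
      then have fixed: "g \<otimes> x \<otimes> inv g = x" if "g \<in> carrier G" for g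
        using x that unfolding orbit_def by auto
      have "x \<otimes> g = g \<otimes> x" if "g \<in> carrier G" for g
      proof -
        have "x \<otimes> g = g \<otimes> x \<otimes> inv g \<otimes> g" using fixed[OF that] by simp
        then show ?thesis using that x(1) by (simp add: m_assoc)
      qed
      then have "x \<in> centralizer G (carrier G)"
        using x(1) unfolding centralizer_def by blast
      then have "x = \<one>" using H by blast
      then show False using x one orb by simp
    qed
    then show ?thesis using i by simp
  qed
  have "(\<Sum>orb\<in>?O. card orb) = order G"
    using disjoint_sum[OF fin, of "\<lambda>_. 1 :: nat"] by (simp add: order_def)
  moreover have "{\<one>} \<in> ?O" using one unfolding orbits_def by blast
  ultimately have sum: "order G = 1 + (\<Sum>orb\<in>?O - {{\<one>}}. card orb)"
    using finO by (simp add: sum.remove[of _ "{\<one>}"])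
  have rest: "p dvd (\<Sum>orb\<in>?O - {{\<one>}}. card orb)"
    by (rule dvd_sum) (rule dvd)
  have "order G \<noteq> 1" using nt order_one_triv_iff by blast
  then have "p dvd order G" using n by (cases n) auto
  then have "p dvd 1" unfolding sum dvd_add_left_iff[OF rest] .
  then show False using p by simp
qed

text \<open>The quotient by the centre is a non-trivial p-group, so its own centre contains a
  non-trivial coset; \<open>y\<close> is any representative of it.\<close>

lemma exists_second_center:
  assumes p: "Factorial_Ring.prime p" and n: "order G = p ^ n"
    and na: "\<not> comm_group G"
  shows "\<exists>y \<in> carrier G. y \<notin> centralizer G (carrier G) \<and>
           (\<forall>g \<in> carrier G. g \<otimes> y \<otimes> inv g \<otimes> inv y \<in> centralizer G (carrier G))"
proof -
  let ?Z = "centralizer G (carrier G)"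
  interpret Z: normal ?Z G by (rule normal_center)
  interpret Q: group "G Mod ?Z" by (rule Z.factorgroup_is_group)
  have "order (G Mod ?Z) * card ?Z = p ^ n"
    using lagrange[OF Z.subgroup_axioms] n by (simp add: order_def FactGroup_def)
  then have "order (G Mod ?Z) dvd p ^ n" by (metis dvd_triv_left)
  then obtain m where m: "order (G Mod ?Z) = p ^ m"
    using divides_primepow_nat[OF p] by blast
  have "order G > 0" using n p by (simp add: prime_gt_0_nat)
  then have fin: "finite (carrier G)" using order_gt_0_iff_finite by auto
  have "?Z \<noteq> carrier G"
  proof
    assume Z: "?Z = carrier G"
    have "comm_group G"
    proof (rule group_comm_groupI)
      fix a b assume "a \<in> carrier G" "b \<in> carrier G"
      then have "a \<in> ?Z" "b \<in> carrier G" using Z by blast+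
      then show "a \<otimes> b = b \<otimes> a" by (rule centralizerD)
    qed
    then show False using na by simp
  qed
  then have "carrier (G Mod ?Z) \<noteq> {\<one>\<^bsub>G Mod ?Z\<^esub>}"
    using Z.fact_group_trivial_iff[OF fin] by simp
  from Q.nontrivial_center[OF p m this]
  obtain Y where Y: "Y \<in> centralizer (G Mod ?Z) (carrier (G Mod ?Z))" "Y \<noteq> ?Z" by auto
  have "Y \<in> (\<lambda>y. ?Z #> y) ` carrier G"
    using centralizer_carrier[OF Y(1)] by (simp only: carrier_FactGroup)
  then obtain y where y: "y \<in> carrier G" "Y = ?Z #> y" by blast
  have "y \<notin> ?Z" using Y(2) y Z.rcos_const by auto
  moreover have "g \<otimes> y \<otimes> inv g \<otimes> inv y \<in> ?Z" if g: "g \<in> carrier G" for g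
  proof -
    have "(?Z #> y) <#> (?Z #> g) = (?Z #> g) <#> (?Z #> y)"
      using centralizerD[OF Y(1), of "?Z #> g"] y(2) g by (simp add: carrier_FactGroup)
    then have "?Z #> (y \<otimes> g) = ?Z #> (g \<otimes> y)"
      using y g by (simp add: Z.rcos_sum)
    then have "g \<otimes> y \<in> ?Z #> (y \<otimes> g)"
      using y g rcos_self Z.subgroup_axioms by (metis m_closed)
    then have "g \<otimes> y \<otimes> inv (y \<otimes> g) \<in> ?Z"
      using y g Z.rcos_module_imp[OF group_axioms] by auto
    then show ?thesis using y g by (simp add: group_word_simps)
  qed
  ultimately show ?thesis using y by blast
qed

text \<open>Collection in class 2: moving one \<open>y\<close> past one \<open>x\<close> costs one
  factor \<open>z\<close>, which commutes with both, and \<open>b * d\<close> such exchanges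
  occur.\<close>

lemma pow_mult_pow_commutator:
  fixes b d :: nat
  assumes G: "x \<in> carrier G" "y \<in> carrier G" "z \<in> carrier G"
    and z: "z \<otimes> x = x \<otimes> z" "z \<otimes> y = y \<otimes> z" and yx: "y \<otimes> x = x \<otimes> y \<otimes> z"
  shows "y [^] b \<otimes> x [^] d = x [^] d \<otimes> y [^] b \<otimes> z [^] (b * d)"
proof -
  have zy: "z [^] i \<otimes> y [^] j = y [^] j \<otimes> z [^] i" for i j :: nat
    using G z by (metis group_commutes_pow nat_pow_closed)
  have zx: "z [^] i \<otimes> x = x \<otimes> z [^] i" for i :: nat
    using G z by (simp add: group_commutes_pow)
  have 1: "y \<otimes> x [^] d = x [^] d \<otimes> y \<otimes> z [^] d" for d :: nat
  proof (induction d)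
    case (Suc d)
    have "y \<otimes> x [^] Suc d = (y \<otimes> x [^] d) \<otimes> x" using G by (simp add: m_assoc)
    also have "\<dots> = x [^] d \<otimes> y \<otimes> (z [^] d \<otimes> x)" using G Suc by (simp add: m_assoc)
    also have "\<dots> = x [^] d \<otimes> (y \<otimes> x) \<otimes> z [^] d" using G zx by (simp add: m_assoc)
    also have "\<dots> = x [^] Suc d \<otimes> y \<otimes> (z \<otimes> z [^] d)" using G yx by (simp add: m_assoc)
    also have "z \<otimes> z [^] d = z [^] Suc d" using G by (metis nat_pow_Suc2)
    finally show ?case .
  qed (use G in simp)
  show ?thesis
  proof (induction b)
    case (Suc b)
    have "y [^] Suc b \<otimes> x [^] d = y [^] b \<otimes> (y \<otimes> x [^] d)" using G by (simp add: m_assoc)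
    also have "\<dots> = (y [^] b \<otimes> x [^] d) \<otimes> y \<otimes> z [^] d" using G 1 by (simp add: m_assoc)
    also have "\<dots> = x [^] d \<otimes> y [^] b \<otimes> (z [^] (b * d) \<otimes> y [^] (1::nat)) \<otimes> z [^] d"
      using G Suc by (simp add: m_assoc)
    also have "\<dots> = x [^] d \<otimes> (y [^] b \<otimes> y) \<otimes> (z [^] (b * d) \<otimes> z [^] d)"
      using G zy[of "b * d" 1] by (simp add: m_assoc)
    finally show ?case using G by (simp add: nat_pow_mult add.commute)
  qed (use G in simp)
qed

lemma ord_eq_prime:
  assumes "Factorial_Ring.prime p" "a \<in> carrier G" "a [^] p = \<one>" "a \<noteq> \<one>"
  shows "ord a = p"
proof -
  have "ord a dvd p" using assms pow_eq_id by blast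
  moreover have "ord a \<noteq> 1" using assms ord_eq_1 by blast
  ultimately show ?thesis using assms(1) by (metis One_nat_def prime_nat_iff)
qed

end

section \<open>The centre and an abelian subgroup of index p\<close>

lemma (in group_hom) card_kernel_mult_card_image:
  "card (kernel G H h) * card (h ` carrier G) = order G"
proof -
  \<comment> \<open>With the codomain cut down to the image the map is onto, so the first
    isomorphism theorem gives a bijection from the cosets of the kernel.\<close>
  let ?I = "H\<lparr>carrier := h ` carrier G\<rparr>"
  have I: "group_hom G ?I h"
    using img_is_subgroup H.subgroup_imp_group G.group_axioms homh
    by (auto simp: group_hom_def group_hom_axioms_def hom_def)
  have k: "kernel G ?I h = kernel G H h" by (simp add: kernel_def)
  have "bij_betw (\<lambda>C. the_elem (h ` C)) (carrier (G Mod (kernel G H h))) (h ` carrier G)"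
    using group_hom.FactGroup_iso_set[OF I] by (simp add: k iso_def)
  then have "card (rcosets (kernel G H h)) = card (h ` carrier G)"
    using bij_betw_same_card by (force simp: FactGroup_def)
  then show ?thesis
    using G.lagrange[OF subgroup_kernel] by (simp add: mult.commute)
qed

context group
begin

text \<open>A non-abelian subgroup \<open>H\<close> generated by \<open>x\<close> and
  \<open>y\<close> is found whose words have the normal form \<open>x^i y^j z^k\<close> with
  \<open>z\<close> central of order \<open>p\<close>. Being self-centralizing, \<open>H\<close>
  contains the centre of \<open>G\<close>, and commuting with \<open>y\<close> and \<open>x\<close>
  kills the first two factors of a central word. So the centre is generated by
  \<open>z\<close>.\<close>

lemma card_center_eq_prime:
  assumes p: "Factorial_Ring.prime p" and n: "order G = p ^ n" and na: "\<not> comm_group G"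
    and expo: "\<And>a. a \<in> carrier G \<Longrightarrow> a [^] p = \<one>"
    and self_centralizing: "\<And>H. subgroup H G \<Longrightarrow> \<not> comm_group (G\<lparr>carrier := H\<rparr>) \<Longrightarrow> centralizer G H \<subseteq> H"
  shows "card (centralizer G (carrier G)) = p"
proof -
  let ?Z = "centralizer G (carrier G)"
  interpret Z: subgroup ?Z G by (simp add: subgroup_centralizer)
  have "order G > 0" using n p by (simp add: prime_gt_0_nat)
  then have fin: "finite (carrier G)" using order_gt_0_iff_finite by auto
  obtain y where y: "y \<in> carrier G" "y \<notin> ?Z"
      and yc: "\<And>g. g \<in> carrier G \<Longrightarrow> g \<otimes> y \<otimes> inv g \<otimes> inv y \<in> ?Z"
    using exists_second_center[OF p n na] by blast
  have "\<exists>x \<in> carrier G. y \<otimes> x \<noteq> x \<otimes> y"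
    using y centralizerI[OF y(1), of "carrier G"] by blast
  then obtain x where x: "x \<in> carrier G" "y \<otimes> x \<noteq> x \<otimes> y" by blast
  \<comment> \<open>This form of the commutator gives \<open>y x = x y z\<close>, the shape needed
    for collection.\<close>
  define z where "z = inv x \<otimes> y \<otimes> x \<otimes> inv y"
  have zZ: "z \<in> ?Z" using yc[of "inv x"] x by (simp add: z_def)
  have z: "z \<in> carrier G" using x y by (simp add: z_def)
  have central: "z [^] k \<otimes> g = g \<otimes> z [^] k" if "g \<in> carrier G" for g and k :: nat
  proof (rule centralizerD[OF _ that])
    show "z [^] k \<in> ?Z" by (induction k) (use zZ in auto)
  qed
  have zg: "z \<otimes> g = g \<otimes> z" if "g \<in> carrier G" for g
    using centralizerD[OF zZ that] .
  have yx: "y \<otimes> x = x \<otimes> y \<otimes> z"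
  proof -
    have "x \<otimes> y \<otimes> z = x \<otimes> (z \<otimes> y)" using x y z zg by (simp add: m_assoc)
    also have "\<dots> = y \<otimes> x" using x y by (simp add: z_def group_word_simps)
    finally show ?thesis ..
  qed
  have "z \<noteq> \<one>" using yx x y by auto
  then have ord_z: "ord z = p" using ord_eq_prime p z expo by blast
  note comm_pow = pow_mult_pow_commutator[OF x(1) y(1) z zg[OF x(1)] zg[OF y(1)] yx]
  \<comment> \<open>No uniqueness of the exponents is claimed: closure under products is enough in a
    finite group.\<close>
  define H where "H = {x [^] i \<otimes> y [^] j \<otimes> z [^] k | (i::nat) (j::nat) (k::nat). True}"
  have "subgroup H G"
  proof (rule subgroup_if_finite_closed[OF fin])
    show "H \<subseteq> carrier G" using x y z by (auto simp: H_def)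
    have "x [^] (0::nat) \<otimes> y [^] (0::nat) \<otimes> z [^] (0::nat) \<in> H" unfolding H_def by blast
    then show "\<one> \<in> H" by simp
    fix g h assume "g \<in> H" "h \<in> H"
    then obtain a b c d e f :: nat where
      g: "g = x [^] a \<otimes> y [^] b \<otimes> z [^] c" and h: "h = x [^] d \<otimes> y [^] e \<otimes> z [^] f"
      unfolding H_def by auto
    have "g \<otimes> h = x [^] a \<otimes> y [^] b \<otimes> (z [^] c \<otimes> (x [^] d \<otimes> y [^] e)) \<otimes> z [^] f"
      using x y z by (simp add: g h m_assoc)
    also have "\<dots> = x [^] a \<otimes> (y [^] b \<otimes> x [^] d) \<otimes> y [^] e \<otimes> (z [^] c \<otimes> z [^] f)"
      using x y z central[of "x [^] d \<otimes> y [^] e" c] by (simp add: m_assoc)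
    also have "\<dots> = x [^] a \<otimes> x [^] d \<otimes> y [^] b \<otimes> (z [^] (b * d) \<otimes> y [^] e) \<otimes> (z [^] c \<otimes> z [^] f)"
      unfolding comm_pow using x y z by (simp add: m_assoc)
    also have "\<dots> = (x [^] a \<otimes> x [^] d) \<otimes> (y [^] b \<otimes> y [^] e) \<otimes> (z [^] (b * d) \<otimes> (z [^] c \<otimes> z [^] f))"
      unfolding central[OF nat_pow_closed[OF y(1)]] using x y z by (simp add: m_assoc)
    also have "\<dots> = x [^] (a + d) \<otimes> y [^] (b + e) \<otimes> z [^] (b * d + (c + f))"
      using x y z by (simp add: nat_pow_mult)
    finally show "g \<otimes> h \<in> H" unfolding H_def by blast
  qed
  moreover have "\<not> comm_group (G\<lparr>carrier := H\<rparr>)"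
  proof
    assume "comm_group (G\<lparr>carrier := H\<rparr>)"
    then interpret H: comm_group "G\<lparr>carrier := H\<rparr>" .
    have "x [^] (1::nat) \<otimes> y [^] (0::nat) \<otimes> z [^] (0::nat) \<in> H"
      "x [^] (0::nat) \<otimes> y [^] (1::nat) \<otimes> z [^] (0::nat) \<in> H"
      unfolding H_def by blast+
    then have "x \<in> H" "y \<in> H" using x y by simp_all
    then have "y \<otimes> x = x \<otimes> y" using H.m_comm[of y x] by simp
    then show False using x(2) by simp
  qed
  ultimately have cent: "centralizer G H \<subseteq> H" and "H \<subseteq> carrier G"
    using self_centralizing subgroup.subset by blast+
  have "?Z \<subseteq> generate G {z}"
  proof
    fix w assume w: "w \<in> ?Z"
    then have "w \<in> centralizer G H"
      using \<open>H \<subseteq> carrier G\<close> unfolding centralizer_def by blast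
    then obtain i j k :: nat where wk: "w = x [^] i \<otimes> y [^] j \<otimes> z [^] k"
      using cent unfolding H_def by blast
    \<comment> \<open>Collecting \<open>y w\<close> produces an extra \<open>z [^] i\<close>
      compared with \<open>w y\<close>, so centrality of \<open>w\<close> forces
      \<open>z [^] i = \<one>\<close>, hence \<open>p\<close> divides \<open>i\<close>.\<close>
    have "x [^] i \<otimes> y [^] Suc j \<otimes> z [^] k = x [^] i \<otimes> y [^] j \<otimes> (z [^] k \<otimes> y)"
      unfolding central[OF y(1)] using x y z by (simp add: m_assoc)
    also have "\<dots> = w \<otimes> y" using x y z by (simp add: wk m_assoc)
    also have "\<dots> = y \<otimes> w" using centralizerD[OF w y(1)] .
    also have "\<dots> = (y [^] (1::nat) \<otimes> x [^] i) \<otimes> y [^] j \<otimes> z [^] k"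
      using x y z by (simp add: wk m_assoc)
    also have "\<dots> = x [^] i \<otimes> y \<otimes> (z [^] i \<otimes> y [^] j) \<otimes> z [^] k"
      unfolding comm_pow using x y z by (simp add: m_assoc)
    also have "\<dots> = x [^] i \<otimes> (y \<otimes> y [^] j) \<otimes> z [^] i \<otimes> z [^] k"
      unfolding central[OF nat_pow_closed[OF y(1)]] using x y z by (simp add: m_assoc)
    also have "y \<otimes> y [^] j = y [^] Suc j" by (metis nat_pow_Suc2 y(1))
    finally have "x [^] i \<otimes> y [^] Suc j \<otimes> z [^] k = x [^] i \<otimes> y [^] Suc j \<otimes> (z [^] i \<otimes> z [^] k)"
      using x y z by (simp add: m_assoc del: nat_pow_Suc)
    then have "z [^] k = z [^] i \<otimes> z [^] k"
      using l_cancel x y z by (metis m_closed nat_pow_closed)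
    then have "z [^] i = \<one>" using z by simp
    then have "p dvd i" using pow_eq_id[OF z] ord_z by simp
    then have xi: "x [^] i = \<one>" using expo x by (metis dvdE nat_pow_one nat_pow_pow)
    \<comment> \<open>With \<open>x [^] i\<close> gone, the same comparison of \<open>x w\<close>
      and \<open>w x\<close> yields \<open>z [^] j = \<one>\<close>.\<close>
    have "x \<otimes> (y [^] j \<otimes> z [^] k) = x \<otimes> w"
      using x y z by (simp add: wk xi)
    also have "\<dots> = w \<otimes> x" using centralizerD[OF w x(1)] by simp
    also have "\<dots> = y [^] j \<otimes> (z [^] k \<otimes> x)"
      using x y z by (simp add: wk xi m_assoc)
    also have "\<dots> = (y [^] j \<otimes> x [^] (1::nat)) \<otimes> z [^] k"
      unfolding central[OF x(1)] using x y z by (simp add: m_assoc)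
    also have "\<dots> = x \<otimes> (y [^] j \<otimes> (z [^] j \<otimes> z [^] k))"
      unfolding comm_pow using x y z by (simp add: m_assoc)
    finally have "z [^] k = z [^] j \<otimes> z [^] k"
      using l_cancel x y z by (metis m_closed nat_pow_closed)
    then have "z [^] j = \<one>" using z by simp
    then have "p dvd j" using pow_eq_id[OF z] ord_z by simp
    then have "y [^] j = \<one>" using expo y by (metis dvdE nat_pow_one nat_pow_pow)
    then have "w = z [^] int k" using wk xi x y z by (simp add: int_pow_int)
    then show "w \<in> generate G {z}" using generate_pow[OF z] by blast
  qed
  moreover have "generate G {z} \<subseteq> ?Z"
    using generate_subgroup_incl Z.subgroup_axioms zZ by blast
  ultimately show ?thesis using generate_pow_card[OF z] ord_z by auto
qed

text \<open>The subgroup is the centralizer of a non-central \<open>y\<close> that is central modulo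
  the centre. Were it non-abelian, its centre would have order \<open>p\<close> by the previous
  lemma, which leaves no room for \<open>y\<close> next to the centre of \<open>G\<close>.\<close>

lemma exists_abelian_index_prime:
  assumes p: "Factorial_Ring.prime p" and n: "order G = p ^ n" and na: "\<not> comm_group G"
    and expo: "\<And>a. a \<in> carrier G \<Longrightarrow> a [^] p = \<one>"
    and self_centralizing: "\<And>H. subgroup H G \<Longrightarrow> \<not> comm_group (G\<lparr>carrier := H\<rparr>) \<Longrightarrow> centralizer G H \<subseteq> H"
  shows "\<exists>A. A \<lhd> G \<and> comm_group (G\<lparr>carrier := A\<rparr>) \<and> card (rcosets A) = p"
proof -
  let ?Z = "centralizer G (carrier G)"
  interpret Z: subgroup ?Z G by (simp add: subgroup_centralizer)
  have "order G > 0" using n p by (simp add: prime_gt_0_nat)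
  then have fin: "finite (carrier G)" using order_gt_0_iff_finite by auto
  obtain y where y: "y \<in> carrier G" "y \<notin> ?Z"
      and yc: "\<And>g. g \<in> carrier G \<Longrightarrow> g \<otimes> y \<otimes> inv g \<otimes> inv y \<in> ?Z"
    using exists_second_center[OF p n na] by blast
  have cardZ: "card ?Z = p" by (rule card_center_eq_prime[OF assms])
  define A where "A = centralizer G {y}"
  have A: "subgroup A G" unfolding A_def by (rule subgroup_centralizer) (use y in auto)
  interpret A: group "G\<lparr>carrier := A\<rparr>" using subgroup_imp_group[OF A] .
  have comm: "comm_group (G\<lparr>carrier := A\<rparr>)"
  proof (rule ccontr)
    assume naA: "\<not> ?thesis"
    have "card A dvd p ^ n" using card_subgroup_dvd[OF A] n by simp
    then obtain m where m: "order (G\<lparr>carrier := A\<rparr>) = p ^ m"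
      using divides_primepow_nat[OF p] by (auto simp: order_def)
    let ?ZA = "centralizer (G\<lparr>carrier := A\<rparr>) (carrier (G\<lparr>carrier := A\<rparr>))"
    have "card ?ZA = p"
    proof (rule A.card_center_eq_prime[OF p m naA])
      show "a [^]\<^bsub>G\<lparr>carrier := A\<rparr>\<^esub> p = \<one>\<^bsub>G\<lparr>carrier := A\<rparr>\<^esub>" if "a \<in> carrier (G\<lparr>carrier := A\<rparr>)" for a
        using expo subgroup.subset[OF A] that by (auto simp flip: nat_pow_consistent)
      \<comment> \<open>The hypothesis passes to \<open>A\<close>: a centralizer taken inside
        \<open>A\<close> is only smaller than the one taken in \<open>G\<close>.\<close>
      show "centralizer (G\<lparr>carrier := A\<rparr>) H \<subseteq> H"
        if "subgroup H (G\<lparr>carrier := A\<rparr>)" "\<not> comm_group (G\<lparr>carrier := A, carrier := H\<rparr>)" for H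
      proof -
        have "centralizer G H \<subseteq> H"
          using self_centralizing incl_subgroup[OF A that(1)] that(2) by simp
        then show ?thesis
          by (simp add: centralizer_carrier_update[OF subgroup.subset[OF A]] le_infI2)
      qed
    qed
    moreover have "insert y ?Z \<subseteq> ?ZA"
    proof -
      have "y \<in> A" unfolding A_def by (rule centralizerI) (use y in auto)
      moreover have "y \<in> centralizer G A"
        by (rule centralizerI[OF y(1)]) (metis A_def centralizerD singletonI)
      moreover have "?Z \<subseteq> A" "?Z \<subseteq> centralizer G A"
        using y(1) subgroup.subset[OF A] unfolding A_def centralizer_def by blast+
      ultimately show ?thesis
        by (simp add: centralizer_carrier_update[OF subgroup.subset[OF A]])
    qed
    moreover have "finite ?ZA"
      using finite_subset[OF subgroup.subset[OF A] fin]
      by (simp add: centralizer_carrier_update[OF subgroup.subset[OF A]])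
    ultimately have "card (insert y ?Z) \<le> p" using card_mono by metis
    moreover have "finite ?Z" using fin by (rule rev_finite_subset) (rule Z.subset)
    ultimately show False using y(2) cardZ by simp
  qed
  \<comment> \<open>The values of \<open>f\<close> are central, so the conjugation in the product
    rule for commutators disappears and \<open>f\<close> is multiplicative. The index of
    \<open>A\<close> is then the order of its image.\<close>
  define f where "f = (\<lambda>g. g \<otimes> y \<otimes> inv g \<otimes> inv y)"
  have f: "f \<in> hom G G"
  proof (rule homI)
    show "f g \<in> carrier G" if "g \<in> carrier G" for g using that y by (simp add: f_def)
    fix g h assume gh: "g \<in> carrier G" "h \<in> carrier G"
    have fh: "f h \<in> carrier G" using gh y by (simp add: f_def)
    have "f (g \<otimes> h) = g \<otimes> f h \<otimes> (y \<otimes> inv g \<otimes> inv y)"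
      using gh y by (simp add: f_def group_word_simps)
    also have "g \<otimes> f h = f h \<otimes> g"
      using centralizerD[OF yc[OF gh(2)] gh(1)] by (simp add: f_def)
    also have "f h \<otimes> g \<otimes> (y \<otimes> inv g \<otimes> inv y) = f h \<otimes> f g"
      using gh y fh by (simp add: m_assoc) (simp add: f_def m_assoc)
    also have "\<dots> = f g \<otimes> f h"
      using centralizerD[OF yc[OF gh(2)]] gh y by (simp add: f_def)
    finally show "f (g \<otimes> h) = f g \<otimes> f h" .
  qed
  interpret f: group_hom G G f by unfold_locales (rule f)
  have ker: "kernel G G f = A"
  proof -
    have "f g = \<one> \<longleftrightarrow> g \<otimes> y = y \<otimes> g" if g: "g \<in> carrier G" for g
    proof -
      have "f g = (g \<otimes> y) \<otimes> inv (y \<otimes> g)" using g y by (simp add: f_def group_word_simps)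
      then show ?thesis using g y inv_solve_right'[of \<one> "g \<otimes> y" "y \<otimes> g"] by simp
    qed
    then show ?thesis unfolding kernel_def A_def centralizer_def by blast
  qed
  have card: "card A * card (f ` carrier G) = order G"
    using f.card_kernel_mult_card_image ker by simp
  \<comment> \<open>The image is a p-group inside a centre of order \<open>p\<close>, and it is not
    trivial because \<open>y\<close> is not central.\<close>
  have "card (f ` carrier G) = p"
  proof -
    have "card (f ` carrier G) dvd p ^ n" using card n by (metis dvd_triv_right)
    then obtain i where i: "card (f ` carrier G) = p ^ i"
      using divides_primepow_nat[OF p] by blast
    have sub: "f ` carrier G \<subseteq> ?Z" using yc by (auto simp: f_def)
    moreover have "finite ?Z" using fin by (rule rev_finite_subset) (rule Z.subset)
    ultimately have "p ^ i \<le> p ^ 1" using card_mono[of ?Z "f ` carrier G"] i cardZ by simp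
    then have "i \<le> 1" using p prime_gt_1_nat power_le_imp_le_exp by blast
    moreover have "i \<noteq> 0"
    proof
      assume "i = 0"
      then have "card A = order G" using i card by simp
      then have "A = carrier G"
        using fin subgroup.subset[OF A] by (simp add: order_def card_subset_eq)
      then have "y \<otimes> g = g \<otimes> y" if "g \<in> carrier G" for g
        using that unfolding A_def by (metis centralizerD singletonI)
      then have "y \<in> ?Z" using y(1) by (rule centralizerI[rotated])
      then show False using y by simp
    qed
    ultimately have "i = 1" by simp
    then show ?thesis using i by simp
  qed
  then have "card (rcosets A) = p"
    using card lagrange[OF A] \<open>order G > 0\<close> by (metis mult.commute mult_cancel2 mult_0 less_numeral_extra(3))
  then show ?thesis using f.normal_kernel ker comm by auto
qed

end

section \<open>Commutation with an element outside an abelian subgroup of index p\<close>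

text \<open>This is the binomial expansion of \<open>(1 - \<psi>)^m\<close> in the endomorphism ring
  of an abelian group, written multiplicatively. The inductive step is Pascal's rule.\<close>

lemma (in comm_group) iterated_difference:
  assumes X: "\<psi> \<in> hom G G"
    and T: "\<And>a. a \<in> carrier G \<Longrightarrow> T a = a \<otimes> inv (\<psi> a)"
    and a: "a \<in> carrier G"
  shows "(T ^^ m) a = (\<Otimes>k\<in>{..m}. (\<psi> ^^ k) a [^] ((-1) ^ k * int (m choose k)))"
  using a
proof (induction m arbitrary: a)
  case 0
  then show ?case by simp
next
  case (Suc m)
  interpret X: group_hom G G \<psi> by unfold_locales (rule X)
  define f where "f = (\<lambda>k. (\<psi> ^^ k) a)"
  define c where "c = (\<lambda>m k. (-1) ^ k * int (m choose k))"
  have f[simp]: "f k \<in> carrier G" for k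
    unfolding f_def by (induction k) (use Suc.prems in auto)
  have Ta: "T a \<in> carrier G" using Suc.prems T by simp
  have Xk: "(\<psi> ^^ k) (T a) = f k \<otimes> inv (f (Suc k))" for k
  proof (induction k)
    case 0
    then show ?case using Suc.prems T by (simp add: f_def)
  next
    case (Suc k)
    have "(\<psi> ^^ Suc k) (T a) = \<psi> (f k \<otimes> inv (f (Suc k)))" using Suc by simp
    also have "\<dots> = \<psi> (f k) \<otimes> inv (\<psi> (f (Suc k)))" by simp
    finally show ?case by (simp add: f_def)
  qed
  have c0: "c (Suc m) 0 = c m 0" "c m 0 = 1" by (simp_all add: c_def)
  have cS: "c (Suc m) (Suc k) = c m (Suc k) + - c m k" for k
    by (simp add: c_def algebra_simps)
  have cm: "c m (Suc m) = 0" by (simp add: c_def)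
  have "(T ^^ Suc m) a = (T ^^ m) (T a)" by (simp add: funpow_Suc_right del: funpow.simps)
  also have "\<dots> = (\<Otimes>k\<in>{..m}. (f k \<otimes> inv (f (Suc k))) [^] c m k)"
    unfolding Suc.IH[OF Ta] Xk c_def ..
  also have "\<dots> = (\<Otimes>k\<in>{..m}. f k [^] c m k \<otimes> f (Suc k) [^] (- c m k))"
    by (intro finprod_cong') (auto simp: int_pow_distrib int_pow_inv int_pow_neg)
  also have "\<dots> = (\<Otimes>k\<in>{..m}. f k [^] c m k) \<otimes> (\<Otimes>k\<in>{..m}. f (Suc k) [^] (- c m k))"
    by (intro finprod_multf) auto
  \<comment> \<open>The added coefficient is zero; extending the range allows index 0 to be split
    off, which aligns this product with the shifted one.\<close>
  also have "(\<Otimes>k\<in>{..m}. f k [^] c m k) = (\<Otimes>k\<in>{..Suc m}. f k [^] c m k)"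
    by (subst finprod_Suc) (auto simp: cm)
  also have "\<dots> = (\<Otimes>k\<in>{..m}. f (Suc k) [^] c m (Suc k)) \<otimes> f 0 [^] c m 0"
    by (rule finprod_Suc2) auto
  also have "(\<Otimes>k\<in>{..m}. f (Suc k) [^] c m (Suc k)) \<otimes> f 0 [^] c m 0 \<otimes> (\<Otimes>k\<in>{..m}. f (Suc k) [^] (- c m k))
    = ((\<Otimes>k\<in>{..m}. f (Suc k) [^] c m (Suc k)) \<otimes> (\<Otimes>k\<in>{..m}. f (Suc k) [^] (- c m k))) \<otimes> f 0 [^] c m 0"
    by (simp add: m_ac Pi_def)
  also have "(\<Otimes>k\<in>{..m}. f (Suc k) [^] c m (Suc k)) \<otimes> (\<Otimes>k\<in>{..m}. f (Suc k) [^] (- c m k))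
     = (\<Otimes>k\<in>{..m}. f (Suc k) [^] c m (Suc k) \<otimes> f (Suc k) [^] (- c m k))"
    by (rule finprod_multf[symmetric]) auto
  also have "\<dots> = (\<Otimes>k\<in>{..m}. f (Suc k) [^] c (Suc m) (Suc k))"
    by (intro finprod_cong') (auto simp: cS int_pow_diff int_pow_neg)
  also have "(\<Otimes>k\<in>{..m}. f (Suc k) [^] c (Suc m) (Suc k)) \<otimes> f 0 [^] c m 0
     = (\<Otimes>k\<in>{..Suc m}. f k [^] c (Suc m) k)"
    using finprod_Suc2[of "\<lambda>k. f k [^] c (Suc m) k" m] c0 by simp
  finally show ?case unfolding f_def c_def .
qed

text \<open>Equivalently, \<open>(1 - X)^(p-1) = 1 + X + ... + X^(p-1)\<close> modulo
  \<open>p\<close>. Since \<open>p\<close> divides \<open>p choose Suc k\<close>, Pascal's rule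
  makes neighbouring coefficients \<open>p - 1 choose k\<close> opposite modulo
  \<open>p\<close>.\<close>

lemma prime_dvd_signed_choose_minus_one:
  assumes p: "Factorial_Ring.prime p" and "k < p"
  shows "int p dvd (-1) ^ k * int ((p - 1) choose k) - 1"
  using assms(2)
proof (induction k)
  case (Suc k)
  have "p choose Suc k = (p - 1 choose k) + (p - 1 choose Suc k)"
    using Suc.prems by (cases p) auto
  then have c: "int (p - 1 choose Suc k) = int (p choose Suc k) - int (p - 1 choose k)"
    by simp
  have "(-1) ^ Suc k * int ((p - 1) choose Suc k) - 1
      = ((-1) ^ k * int ((p - 1) choose k) - 1) + (-1) ^ Suc k * int (p choose Suc k)"
    unfolding c by (simp add: algebra_simps)
  moreover have "p dvd p choose Suc k"
    by (rule dvd_choose_prime) (use Suc.prems p in auto)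
  ultimately show ?case
    using Suc by (metis Suc_lessD dvd_add dvd_mult of_nat_dvd_iff)
qed simp

section \<open>The map \<open>T\<close> and its effect on subgroups of \<open>A\<close>\<close>

locale prime_index_abelian = group G for G (structure) +
  fixes p :: nat and A x
  assumes prime: "Factorial_Ring.prime p"
    and fin: "finite (carrier G)"
    and normal: "A \<lhd> G"
    and abelian: "comm_group (G\<lparr>carrier := A\<rparr>)"
    and index: "card (rcosets A) = p"
    and x: "x \<in> carrier G" "x \<notin> A"
begin

sublocale A: subgroup A G
  using normal by (rule normal_imp_subgroup)

definition T where "T a = a \<otimes> x \<otimes> inv a \<otimes> inv x"

lemma A_comm: "a \<in> A \<Longrightarrow> b \<in> A \<Longrightarrow> a \<otimes> b = b \<otimes> a"
  using comm_monoid.m_comm[OF comm_group.axioms(1)[OF abelian]] by simp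

lemma conj_A: "g \<in> carrier G \<Longrightarrow> a \<in> A \<Longrightarrow> g \<otimes> a \<otimes> inv g \<in> A"
  using normal by (simp add: normal_inv_iff)

text \<open>Index is multiplicative along \<open>A\<close>, \<open>S\<close>, \<open>G\<close>, so
  prime index makes \<open>A\<close> a maximal subgroup.\<close>

lemma whole_group_if_contains:
  assumes S: "subgroup S G" and "A \<subseteq> S" "x \<in> S"
  shows "S = carrier G"
proof -
  interpret S: group "G\<lparr>carrier := S\<rparr>" using subgroup_imp_group[OF S] .
  have finS: "finite S" using finite_subset[OF subgroup.subset[OF S] fin] .
  have finA: "finite A" using finite_subset[OF assms(2) finS] .
  have pos: "card A > 0" using finA A.one_closed by (metis card_gt_0_iff empty_iff)
  have "card A dvd card S"
    using S.card_subgroup_dvd[OF subgroup_incl[OF A.subgroup_axioms S assms(2)]]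
    by (simp add: order_def)
  then obtain l where l: "card S = l * card A" by (metis dvdE mult.commute)
  have "card (rcosets S) * l * card A = p * card A"
    using lagrange[OF S] lagrange[OF A.subgroup_axioms] index l by simp
  then have kl: "card (rcosets S) * l = p" using pos by simp
  have "A \<subset> S" using assms x by blast
  then have "card A < card S" using finS psubset_card_mono by blast
  then have "l \<noteq> 1" using l by auto
  then have "l = p" using kl prime by (metis dvd_triv_right prime_nat_iff)
  then have "card (rcosets S) = 1" using kl prime by simp
  then have "card S = card (carrier G)" using lagrange[OF S] by (simp add: order_def)
  then show ?thesis using card_subset_eq[OF fin subgroup.subset[OF S]] by simp
qed

lemma mult_closed_set_eq_carrier:
  assumes "S \<subseteq> carrier G" "A \<subseteq> S" "x \<in> S" "\<And>g h. g \<in> S \<Longrightarrow> h \<in> S \<Longrightarrow> g \<otimes> h \<in> S"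
  shows "S = carrier G"
  using assms by (intro whole_group_if_contains subgroup_if_finite_closed[OF fin]) auto

text \<open>In additive notation on \<open>A\<close>, \<open>T\<close> is the identity minus
  conjugation by \<open>x\<close>.\<close>

lemma T_conj: "a \<in> A \<Longrightarrow> T a = a \<otimes> inv (x \<otimes> a \<otimes> inv x)"
  using x by (simp add: T_def group_word_simps)

lemma T_closed: "a \<in> A \<Longrightarrow> T a \<in> A"
  using T_conj conj_A[OF x(1)] by auto

lemma T_mult:
  assumes "a \<in> A" "b \<in> A"
  shows "T (a \<otimes> b) = T a \<otimes> T b"
proof -
  let ?c = "\<lambda>a. x \<otimes> inv a \<otimes> inv x"
  have c: "?c a \<in> A" "?c b \<in> A" using conj_A[OF x(1)] assms by auto
  have "T (a \<otimes> b) = a \<otimes> (b \<otimes> ?c b) \<otimes> ?c a"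
    using assms x by (simp add: T_def group_word_simps)
  also have "\<dots> = a \<otimes> ((b \<otimes> ?c b) \<otimes> ?c a)"
    using assms c by (simp add: m_assoc)
  also have "\<dots> = a \<otimes> (?c a \<otimes> (b \<otimes> ?c b))"
    using A_comm[of "b \<otimes> ?c b" "?c a"] assms c by simp
  also have "\<dots> = T a \<otimes> T b"
    using assms x by (simp add: T_def group_word_simps)
  finally show ?thesis .
qed

lemma T_hom: "T \<in> hom (G\<lparr>carrier := A\<rparr>) G"
  by (rule homI) (auto simp: T_mult dest: T_closed)

text \<open>The centralizer of \<open>a\<close> contains \<open>A\<close> because \<open>A\<close>
  is abelian, and \<open>x\<close> because \<open>T a = \<one>\<close>; maximality of
  \<open>A\<close> does the rest.\<close>

lemma kernel_T_central:
  assumes "a \<in> A" "T a = \<one>"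
  shows "a \<in> centralizer G (carrier G)"
proof -
  have "subgroup (centralizer G {a}) G" using assms by (intro subgroup_centralizer) auto
  moreover have "A \<subseteq> centralizer G {a}"
    using A_comm assms(1) by (auto intro!: centralizerI)
  moreover have "x \<in> centralizer G {a}"
  proof (rule centralizerI[OF x(1)])
    fix h assume "h \<in> {a}"
    have "a \<otimes> x = T a \<otimes> (x \<otimes> a)" using assms(1) x by (simp add: T_def group_word_simps)
    then show "x \<otimes> h = h \<otimes> x" using \<open>h \<in> {a}\<close> assms x by simp
  qed
  ultimately have "centralizer G {a} = carrier G" by (rule whole_group_if_contains)
  then show ?thesis
    using assms(1) by (intro centralizerI) (auto, metis centralizerD singletonI)
qed

lemma subgroup_T_image:
  assumes "subgroup B G" "B \<subseteq> A"
  shows "subgroup (T ` B) G"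
proof -
  interpret h: group_hom "G\<lparr>carrier := A\<rparr>" G T
    using T_hom subgroup_imp_group[OF A.subgroup_axioms] group_axioms
    by (simp add: group_hom_def group_hom_axioms_def)
  show ?thesis
    using h.subgroup_img_is_subgroup[OF subgroup_incl[OF assms(1) A.subgroup_axioms assms(2)]] .
qed

text \<open>The kernel of \<open>T\<close> on \<open>B\<close> lies in the centre of
  \<open>G\<close>, so one application of \<open>T\<close> shrinks a subgroup by at most the order
  of the centre.\<close>

lemma card_T_image:
  assumes "subgroup B G" "B \<subseteq> A"
  shows "card B \<le> card (centralizer G (carrier G)) * card (T ` B)"
proof -
  interpret h: group_hom "G\<lparr>carrier := B\<rparr>" G T
    using T_hom subgroup_imp_group[OF assms(1)] group_axioms assms(2)
    by (auto simp: group_hom_def group_hom_axioms_def hom_def)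
  have "kernel (G\<lparr>carrier := B\<rparr>) G T \<subseteq> centralizer G (carrier G)"
    using kernel_T_central assms(2) by (auto simp: kernel_def)
  moreover have "finite (centralizer G (carrier G))"
    using fin by (rule rev_finite_subset) (auto intro: centralizer_carrier)
  ultimately have "card (kernel (G\<lparr>carrier := B\<rparr>) G T) \<le> card (centralizer G (carrier G))"
    by (simp add: card_mono)
  then have "card (kernel (G\<lparr>carrier := B\<rparr>) G T) * card (T ` B)
      \<le> card (centralizer G (carrier G)) * card (T ` B)"
    by (rule mult_le_mono1)
  moreover have "card (kernel (G\<lparr>carrier := B\<rparr>) G T) * card (T ` B) = card B"
    using h.card_kernel_mult_card_image by (simp add: order_def)
  ultimately show ?thesis by (simp only:)
qed

text \<open>
  Both claims concern all of \<open>G\<close>; since \<open>A\<close> is maximal, it suffices that the set of good elements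
  is closed under multiplication and contains \<open>A\<close> and \<open>x\<close>.
\<close>
lemma commutator_mem_T_image:
  assumes B: "subgroup B G" "B \<subseteq> A" "T ` B \<subseteq> B" and b: "b \<in> B" and g: "g \<in> carrier G"
  shows "T ` B \<lhd> G" "b \<otimes> g \<otimes> inv b \<otimes> inv g \<in> T ` B"
proof -
  let ?N = "T ` B"
  interpret N: subgroup ?N G using subgroup_T_image[OF B(1,2)] .
  have NA: "n \<in> A" if "n \<in> ?N" for n using that B by blast
  define S where "S = {g \<in> carrier G. \<forall>n \<in> ?N. g \<otimes> n \<otimes> inv g \<in> ?N}"
  have "S = carrier G"
  proof (rule mult_closed_set_eq_carrier)
    show "S \<subseteq> carrier G" by (auto simp: S_def)
    have "a \<otimes> n \<otimes> inv a \<in> ?N" if "a \<in> A" "n \<in> ?N" for a n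
      using conj_eq_self[OF _ _ A_comm[OF that(1) NA[OF that(2)]]] that NA by simp
    then show "A \<subseteq> S" by (auto simp: S_def)
    have "x \<otimes> n \<otimes> inv x \<in> ?N" if "n \<in> ?N" for n
    proof -
      have "T n \<in> ?N" using that B(3) by blast
      then have "inv (T n) \<otimes> n \<in> ?N" using that by blast
      then show ?thesis
        unfolding T_def using conj_eq_inv_commutator_mult[OF N.mem_carrier[OF that] x(1)] by simp
    qed
    then show "x \<in> S" using x by (auto simp: S_def)
    fix g h assume gh: "g \<in> S" "h \<in> S"
    then have gG: "g \<in> carrier G" "h \<in> carrier G" by (auto simp: S_def)
    have "g \<otimes> h \<otimes> n \<otimes> inv (g \<otimes> h) \<in> ?N" if "n \<in> ?N" for n
      unfolding conj_mult[OF gG N.mem_carrier[OF that]] using gh that unfolding S_def by blast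
    then show "g \<otimes> h \<in> S" using gG by (simp add: S_def)
  qed
  then show "?N \<lhd> G"
    using N.subgroup_axioms unfolding normal_inv_iff S_def by blast
  then have conjN: "g \<otimes> n \<otimes> inv g \<in> ?N" if "g \<in> carrier G" "n \<in> ?N" for g n
    using that unfolding normal_inv_iff by blast
  have bG: "b \<in> carrier G" "b \<in> A" using b B by auto
  define R where "R = {g \<in> carrier G. b \<otimes> g \<otimes> inv b \<otimes> inv g \<in> ?N}"
  have "R = carrier G"
  proof (rule mult_closed_set_eq_carrier)
    show "R \<subseteq> carrier G" by (auto simp: R_def)
    have "b \<otimes> a \<otimes> inv b \<otimes> inv a = \<one>" if "a \<in> A" for a
      using commutator_eq_one[OF _ _ A_comm[OF bG(2) that]] bG that by simp
    then show "A \<subseteq> R" by (auto simp: R_def)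
    show "x \<in> R" using x b by (auto simp: R_def T_def)
    \<comment> \<open>The commutator of \<open>b\<close> with a product involves a conjugate, which
      is why normality is established first.\<close>
    fix g h assume gh: "g \<in> R" "h \<in> R"
    then show "g \<otimes> h \<in> R"
      using commutator_mult_right[OF bG(1), of g h] conjN by (simp add: R_def)
  qed
  then show "b \<otimes> g \<otimes> inv b \<otimes> inv g \<in> ?N" using g by (auto simp: R_def)
qed

text \<open>Here neither entry is confined to \<open>A\<close>, so the closure argument runs twice:
  first over the right entry with \<open>x\<close> on the left, then over the left entry with
  \<open>h\<close> fixed.\<close>

lemma commutator_mem_T_image_A:
  assumes g: "g \<in> carrier G" and h: "h \<in> carrier G"
  shows "g \<otimes> h \<otimes> inv g \<otimes> inv h \<in> T ` A"
proof -
  let ?N = "T ` A"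
  interpret N: subgroup ?N G using subgroup_T_image[OF A.subgroup_axioms order_refl] .
  have TA: "T ` A \<subseteq> A" using T_closed by blast
  note comm_A = commutator_mem_T_image[OF A.subgroup_axioms order_refl TA]
  have conjN: "g \<otimes> n \<otimes> inv g \<in> ?N" if "g \<in> carrier G" "n \<in> ?N" for g n
    using comm_A(1)[OF A.one_closed one_closed] that unfolding normal_inv_iff by blast
  have comm_x: "x \<otimes> h \<otimes> inv x \<otimes> inv h \<in> ?N" if h: "h \<in> carrier G" for h
  proof -
    define R where "R = {h \<in> carrier G. x \<otimes> h \<otimes> inv x \<otimes> inv h \<in> ?N}"
    have "R = carrier G"
    proof (rule mult_closed_set_eq_carrier)
      show "R \<subseteq> carrier G" by (auto simp: R_def)
      have "x \<otimes> a \<otimes> inv x \<otimes> inv a \<in> ?N" if "a \<in> A" for a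
        using N.m_inv_closed[OF imageI[OF that]] inv_commutator[OF A.mem_carrier[OF that] x(1)]
        by (simp add: T_def)
      then show "A \<subseteq> R" by (auto simp: R_def)
      show "x \<in> R" using x(1) commutator_eq_one[OF x(1) x(1)] by (simp add: R_def)
      fix g h assume gh: "g \<in> R" "h \<in> R"
      then show "g \<otimes> h \<in> R"
        using commutator_mult_right[OF x(1), of g h] conjN by (simp add: R_def)
    qed
    then show ?thesis using h by (auto simp: R_def)
  qed
  define R where "R = {g \<in> carrier G. g \<otimes> h \<otimes> inv g \<otimes> inv h \<in> ?N}"
  have "R = carrier G"
  proof (rule mult_closed_set_eq_carrier)
    show "R \<subseteq> carrier G" by (auto simp: R_def)
    show "A \<subseteq> R" using comm_A(2) h by (auto simp: R_def)
    show "x \<in> R" using comm_x h x by (auto simp: R_def)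
    fix g k assume gk: "g \<in> R" "k \<in> R"
    then show "g \<otimes> k \<in> R"
      using commutator_mult_left[OF _ _ h, of g k] conjN by (simp add: R_def)
  qed
  then show ?thesis using g by (auto simp: R_def)
qed

section \<open>The chain of iterated images and the lower central series\<close>

definition D where "D i = (T ^^ i) ` A"

lemma D_0: "D 0 = A"
  by (simp add: D_def)

lemma D_Suc: "D (Suc i) = T ` D i"
  by (simp add: D_def image_comp)

lemma D_antimono: "D (Suc i) \<subseteq> D i"
proof (induction i)
  case 0
  then show ?case using T_closed by (auto simp: D_Suc D_0)
next
  case (Suc i)
  show ?case unfolding D_Suc[of "Suc i"] D_Suc[of i] by (rule image_mono) (rule Suc.IH[unfolded D_Suc])
qed

lemma subgroup_D: "subgroup (D i) G" and D_subset: "D i \<subseteq> A"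
proof -
  have "subgroup (D i) G \<and> D i \<subseteq> A"
  proof (induction i)
    case 0
    then show ?case using A.subgroup_axioms by (simp add: D_0)
  next
    case (Suc i)
    then show ?case using subgroup_T_image D_antimono[of i] unfolding D_Suc by blast
  qed
  then show "subgroup (D i) G" "D i \<subseteq> A" by auto
qed

lemma D_subset_lower_central: "D i \<subseteq> lower_central G i"
proof (induction i)
  case 0
  then show ?case using A.subset by (simp add: D_0)
next
  case (Suc i)
  show ?case
  proof
    fix b assume "b \<in> D (Suc i)"
    then obtain a where a: "a \<in> D i" "b = a \<otimes> x \<otimes> inv a \<otimes> inv x"
      unfolding D_Suc T_def by blast
    then have "a \<in> lower_central G i" using Suc by blast
    then show "b \<in> lower_central G (Suc i)"
      unfolding a(2) lower_central.simps commutator_subgroup_def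
      using x by (blast intro: generate.incl)
  qed
qed

text \<open>The inclusion starts at index 1: at index 0 the series is all of \<open>G\<close>,
  whereas \<open>D 0\<close> is the proper subgroup \<open>A\<close>.\<close>

lemma lower_central_subset_D: "lower_central G (Suc i) \<subseteq> D (Suc i)"
proof (induction i)
  case 0
  show ?case
    unfolding lower_central.simps commutator_subgroup_def
    using commutator_mem_T_image_A by (intro generate_subgroup_incl subgroup_D) (auto simp: D_Suc D_0)
next
  case (Suc i)
  have TD: "T ` D (Suc i) \<subseteq> D (Suc i)" using D_antimono[of "Suc i"] unfolding D_Suc .
  have "b \<otimes> g \<otimes> inv b \<otimes> inv g \<in> D (Suc (Suc i))"
    if b: "b \<in> lower_central G (Suc i)" and g: "g \<in> carrier G" for b g
    unfolding D_Suc[of "Suc i"]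
    using commutator_mem_T_image(2)[OF subgroup_D D_subset TD subsetD[OF Suc.IH b] g] .
  then show ?case
    unfolding lower_central.simps(2)[of _ "Suc i"] commutator_subgroup_def
    by (intro generate_subgroup_incl subgroup_D) blast
qed

text \<open>
  Additively, with \<open>\<psi>\<close> denoting conjugation by \<open>x\<close>, we have
  \<open>T\<^sup>p\<^sup>-\<^sup>1 = (1 - \<psi>)\<^sup>p\<^sup>-\<^sup>1 = \<Sum>\<^sub>k\<^sub><\<^sub>p \<psi>\<^sup>k\<close> modulo \<open>p\<close>, and \<open>(a x)\<^sup>p = (\<Sum>\<^sub>k\<^sub><\<^sub>p \<psi>\<^sup>k) a \<cdot> x\<^sup>p\<close>.
\<close>
lemma funpow_T_eq_one:
  assumes expo: "\<And>g. g \<in> carrier G \<Longrightarrow> g [^] p = \<one>" and a: "a \<in> A"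
  shows "(T ^^ (p - 1)) a = \<one>"
proof -
  let ?GA = "G\<lparr>carrier := A\<rparr>"
  interpret AG: comm_group ?GA by (rule abelian)
  define \<psi> where "\<psi> = (\<lambda>a. x \<otimes> a \<otimes> inv x)"
  have \<psi>A: "\<psi> b \<in> A" if "b \<in> A" for b using conj_A[OF x(1) that] by (simp add: \<psi>_def)
  have \<psi>: "\<psi> \<in> hom ?GA ?GA"
  proof (rule homI)
    fix b c assume "b \<in> carrier ?GA" "c \<in> carrier ?GA"
    then have bc: "b \<in> carrier G" "c \<in> carrier G" by auto
    have "x \<otimes> (b \<otimes> c) \<otimes> inv x = x \<otimes> b \<otimes> inv x \<otimes> (x \<otimes> c \<otimes> inv x)"
      using bc x(1) by (simp add: group_word_simps)
    then show "\<psi> (b \<otimes>\<^bsub>?GA\<^esub> c) = \<psi> b \<otimes>\<^bsub>?GA\<^esub> \<psi> c" by (simp add: \<psi>_def)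
  qed (use \<psi>A in simp)
  have T: "T b = b \<otimes>\<^bsub>?GA\<^esub> inv\<^bsub>?GA\<^esub> (\<psi> b)" if "b \<in> carrier ?GA" for b
    using that \<psi>A T_conj m_inv_consistent[OF A.subgroup_axioms, of "\<psi> b"] by (simp add: \<psi>_def)
  have k: "(\<psi> ^^ k) a \<in> A" for k
    by (induction k) (use a \<psi>A in auto)
  have conj_pow: "(\<psi> ^^ k) a = x [^] k \<otimes> a \<otimes> inv (x [^] k)" for k
  proof (induction k)
    case 0
    then show ?case using A.mem_carrier[OF a] by simp
  next
    case (Suc k)
    have "(\<psi> ^^ Suc k) a = x \<otimes> (x [^] k \<otimes> a \<otimes> inv (x [^] k)) \<otimes> inv x"
      using Suc by (simp add: \<psi>_def)
    also have "\<dots> = (x \<otimes> x [^] k) \<otimes> a \<otimes> inv (x \<otimes> x [^] k)"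
      using conj_mult[OF x(1) nat_pow_closed[OF x(1)] A.mem_carrier[OF a]] by simp
    also have "x \<otimes> x [^] k = x [^] Suc k" by (metis nat_pow_Suc2 x(1))
    finally show ?case .
  qed
  \<comment> \<open>\<open>P m\<close> gathers the conjugates of \<open>a\<close> that appear when
    all factors \<open>x\<close> in \<open>(a \<otimes> x) [^] m\<close> are moved to the
    right.\<close>
  define P where "P m = finprod ?GA (\<lambda>k. (\<psi> ^^ k) a) {..<m}" for m
  have PA: "P m \<in> A" for m
    unfolding P_def using AG.finprod_closed[of "\<lambda>k. (\<psi> ^^ k) a" "{..<m}"] k by auto
  have pow: "(a \<otimes> x) [^] m = P m \<otimes> x [^] m" for m :: nat
  proof (induction m)
    case 0
    then show ?case by (simp add: P_def)
  next
    case (Suc m)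
    have PG: "P m \<in> carrier G" and aG: "a \<in> carrier G" using PA a by auto
    have "P (Suc m) = (\<psi> ^^ m) a \<otimes> P m"
      unfolding P_def lessThan_Suc using k by (subst AG.finprod_insert) auto
    also have "\<dots> = P m \<otimes> (\<psi> ^^ m) a" using A_comm[OF k PA] .
    finally have "P (Suc m) \<otimes> x [^] Suc m
        = P m \<otimes> (x [^] m \<otimes> a \<otimes> inv (x [^] m)) \<otimes> (x [^] m \<otimes> x)"
      by (simp add: conj_pow)
    also have "\<dots> = (P m \<otimes> x [^] m) \<otimes> (a \<otimes> x)"
      using PG aG x(1) nat_pow_closed[OF x(1), of m] by (simp add: group_word_simps del: nat_pow_closed)
    finally show ?case using Suc by simp
  qed
  have "P p = \<one>"
    using pow[of p] expo[OF m_closed[OF A.mem_carrier[OF a] x(1)]] expo[OF x(1)]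
      A.mem_carrier[OF PA[of p]] by simp
  moreover have "(T ^^ (p - 1)) a = P p"
  proof -
    let ?c = "\<lambda>k. (-1) ^ k * int ((p - 1) choose k)"
    have one: "b [^]\<^bsub>?GA\<^esub> (int p) = \<one>\<^bsub>?GA\<^esub>" if "b \<in> A" for b
    proof -
      have "b [^]\<^bsub>?GA\<^esub> p = \<one>" using expo[OF A.mem_carrier[OF that]] by (simp add: nat_pow_consistent[symmetric])
      then show ?thesis by (simp add: int_pow_int)
    qed
    \<comment> \<open>Since \<open>b^p\<close> is trivial on \<open>A\<close>, exponents count only
      modulo \<open>p\<close>, and every signed binomial coefficient is 1 there.\<close>
    have red: "(\<psi> ^^ k) a [^]\<^bsub>?GA\<^esub> ?c k = (\<psi> ^^ k) a" if kp: "k < p" for k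
    proof -
      obtain q where q: "?c k - 1 = int p * q"
        using prime_dvd_signed_choose_minus_one[OF prime kp] by (elim dvdE)
      have kA: "(\<psi> ^^ k) a \<in> carrier ?GA" using k by simp
      have "(\<psi> ^^ k) a [^]\<^bsub>?GA\<^esub> ?c k = (\<psi> ^^ k) a [^]\<^bsub>?GA\<^esub> (1 + int p * q)"
        using q by (simp add: algebra_simps)
      also have "\<dots> = (\<psi> ^^ k) a [^]\<^bsub>?GA\<^esub> (1::int) \<otimes>\<^bsub>?GA\<^esub> (\<psi> ^^ k) a [^]\<^bsub>?GA\<^esub> (int p * q)"
        by (rule AG.int_pow_mult[OF kA])
      also have "(\<psi> ^^ k) a [^]\<^bsub>?GA\<^esub> (int p * q) = ((\<psi> ^^ k) a [^]\<^bsub>?GA\<^esub> int p) [^]\<^bsub>?GA\<^esub> q"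
        by (rule AG.int_pow_pow[OF kA, symmetric])
      also have "\<dots> = \<one>\<^bsub>?GA\<^esub>" unfolding one[OF k] by (rule AG.int_pow_one)
      also have "(\<psi> ^^ k) a [^]\<^bsub>?GA\<^esub> (1::int) \<otimes>\<^bsub>?GA\<^esub> \<one>\<^bsub>?GA\<^esub> = (\<psi> ^^ k) a"
        by (metis AG.int_pow_1 AG.r_one kA)
      finally show ?thesis .
    qed
    have "p > 0" using prime prime_gt_0_nat by blast
    then have set: "{..p - 1} = {..<p}" by auto
    have "(T ^^ (p - 1)) a = finprod ?GA (\<lambda>k. (\<psi> ^^ k) a [^]\<^bsub>?GA\<^esub> ?c k) {..<p}"
      using AG.iterated_difference[OF \<psi> T, of a "p - 1"] a unfolding set by simp
    also have "\<dots> = P p"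
      unfolding P_def by (rule AG.finprod_cong') (use k red in auto)
    finally show ?thesis .
  qed
  ultimately show ?thesis by simp
qed

text \<open>Each step of the chain \<open>D\<close> loses at most a factor \<open>p\<close>, because
  the kernel of \<open>T\<close> lies in the centre, and at least a factor \<open>p\<close> until
  the chain is trivial. So it first becomes trivial at index \<open>n - 1\<close>, while
  \<open>D (p - 1)\<close> is already trivial.\<close>

lemma maximal_class_and_bound:
  assumes expo: "\<And>g. g \<in> carrier G \<Longrightarrow> g [^] p = \<one>"
    and cardZ: "card (centralizer G (carrier G)) = p"
    and n: "order G = p ^ n" "n \<ge> 2"
  shows "maximal_class p G" "n \<le> p"
proof -
  have p1: "p > 1" using prime prime_gt_1_nat by blast
  \<comment> \<open>With this shift \<open>A\<close> has order \<open>p ^ Suc m\<close>, and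
    \<open>Suc m\<close> is the class \<open>n - 1\<close> to be attained.\<close>
  obtain m where m: "n = Suc (Suc m)" using le_Suc_ex[OF n(2)] by auto
  have "p * card A = p * p ^ Suc m"
    using lagrange[OF A.subgroup_axioms] index n(1) m by simp
  then have cardA: "card A = p ^ Suc m" using p1 by simp
  have finD: "finite (D i)" for i
    using finite_subset[OF subgroup.subset[OF subgroup_D] fin] .
  have oneD: "\<one> \<in> D i" for i using subgroup.one_closed[OF subgroup_D] .
  have lower: "p ^ Suc m \<le> p ^ i * card (D i)" for i
  proof (induction i)
    case 0
    then show ?case using cardA by (simp add: D_0)
  next
    case (Suc i)
    have "card (D i) \<le> p * card (D (Suc i))"
      using card_T_image[OF subgroup_D D_subset, of i] unfolding cardZ D_Suc .
    then have "p ^ i * card (D i) \<le> p ^ Suc i * card (D (Suc i))" by simp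
    then show ?case using Suc by (rule order_trans[rotated])
  qed
  have Dp: "D (p - 1) = {\<one>}"
    using oneD[of "p - 1"] funpow_T_eq_one[OF expo] unfolding D_def by blast
  have "p ^ Suc m \<le> p ^ (p - 1)" using lower[of "p - 1"] Dp by simp
  then have "Suc m \<le> p - 1" using p1 power_le_imp_le_exp by blast
  then show "n \<le> p" using m by simp
  \<comment> \<open>A chain that stalls at \<open>i\<close> stays constant from there on, yet
    \<open>p - 1\<close> steps later it lies inside the trivial \<open>D (p - 1)\<close>.\<close>
  have triv: "D i = {\<one>}" if eq: "D (Suc i) = D i" for i
  proof -
    have "D (i + k) = D i" for k
    proof (induction k)
      case (Suc k)
      have "D (i + Suc k) = T ` D (i + k)" by (simp add: D_Suc)
      also have "\<dots> = D i" unfolding Suc D_Suc[symmetric] by (rule eq)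
      finally show ?case .
    qed simp
    moreover have "D (i + (p - 1)) \<subseteq> D (p - 1)"
    proof (induction i)
      case (Suc i)
      then show ?case using D_antimono[of "i + (p - 1)"] by simp
    qed simp
    ultimately have "D i \<subseteq> {\<one>}" unfolding Dp by metis
    then show ?thesis using oneD[of i] by blast
  qed
  \<comment> \<open>The inequality on \<open>j\<close> covers both a strict drop and a stalled,
    hence trivial, term. Truncated subtraction makes the bound 0 at
    \<open>i = Suc m\<close>.\<close>
  have upper: "\<exists>j \<le> Suc m - i. card (D i) = p ^ j" for i
  proof (induction i)
    case 0
    then show ?case using cardA by (auto simp: D_0)
  next
    case (Suc i)
    then obtain j where j: "j \<le> Suc m - i" "card (D i) = p ^ j" by blast
    show ?case
    proof (cases "D (Suc i) = D i")
      case True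
      have "card (D (Suc i)) = p ^ 0" using triv[OF True] True by simp
      then show ?thesis by blast
    next
      case False
      then have less: "card (D (Suc i)) < p ^ j"
        using psubset_card_mono[OF finD[of i], of "D (Suc i)"] D_antimono[of i] j(2) by auto
      have "card (D (Suc i)) dvd p ^ n" using card_subgroup_dvd[OF subgroup_D] n(1) by metis
      then obtain j' where j': "card (D (Suc i)) = p ^ j'"
        using divides_primepow_nat[OF prime] by blast
      then have "j' < j" using less p1 power_less_imp_less_exp by metis
      then have "j' \<le> Suc m - Suc i" using j(1) by simp
      then show ?thesis using j' by blast
    qed
  qed
  have "card (D (Suc m)) = 1" using upper[of "Suc m"] by auto
  then have "D (Suc m) = {\<one>}" using oneD[of "Suc m"] by (metis card_1_singletonE singletonD)
  then have lc: "lower_central G (Suc m) = {\<one>}"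
    using lower_central_subset_D[of m] D_subset_lower_central[of "Suc m"] by blast
  have "nilpotency_class G = Suc m"
    unfolding nilpotency_class_def
  proof (rule Least_equality)
    show "lower_central G (Suc m) = {\<one>}" by (rule lc)
  next
    \<comment> \<open>No earlier term is trivial, by the lower bound on the orders of the
      \<open>D i\<close>.\<close>
    fix c assume c: "lower_central G c = {\<one>}"
    then have "D c = {\<one>}" using D_subset_lower_central[of c] oneD[of c] by blast
    then have "p ^ Suc m \<le> p ^ c" using lower[of c] by simp
    then show "Suc m \<le> c" using p1 power_le_imp_le_exp by blast
  qed
  then show "maximal_class p G"
    unfolding maximal_class_def nilpotent_group_def using lc n m is_group by fastforce
qed

end

theorem theorem6p14:
  fixes G (structure) and p :: nat
  assumes "Factorial_Ring.prime p"
    and "group G" and "finite (carrier G)"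
    and "\<exists>n. order G = p ^ n"
    and "has_exponent G p"
    and "\<And>H. subgroup H G \<Longrightarrow> \<not> comm_group (G\<lparr>carrier := H\<rparr>) \<Longrightarrow> centralizer G H \<subseteq> H"
  shows "(order G > p ^ p \<longrightarrow> elementary_abelian p G)
       \<and> (order G \<le> p ^ p \<longrightarrow>
            (elementary_abelian p G
             \<or> (maximal_class p G
                \<and> (\<exists>A. subgroup A G \<and> card (rcosets A) = p
                       \<and> elementary_abelian p (G\<lparr>carrier := A\<rparr>)))))"
proof -
  interpret group G by fact
  note p = assms(1)
  have expo: "g [^] p = \<one>" if "g \<in> carrier G" for g
    using assms(5) that unfolding has_exponent_def by blast
  obtain n where n: "order G = p ^ n" using assms(4) by blast
  show ?thesis
  proof (cases "comm_group G")
    case True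
    then show ?thesis using expo unfolding elementary_abelian_def by blast
  next
    case na: False
    obtain A where A: "A \<lhd> G" "comm_group (G\<lparr>carrier := A\<rparr>)" "card (rcosets A) = p"
      using exists_abelian_index_prime[OF p n na expo assms(6)] by blast
    have sub: "subgroup A G" using A(1) by (rule normal_imp_subgroup)
    have p1: "p > 1" using p prime_gt_1_nat by blast
    have pos: "order G > 0" using n p1 by simp
    have "A \<noteq> carrier G"
    proof
      assume "A = carrier G"
      then have "p * order G = order G" using lagrange[OF sub] A(3) by (simp add: order_def)
      then show False using pos p1 by simp
    qed
    then obtain x where x: "x \<in> carrier G" "x \<notin> A" using subgroup.subset[OF sub] by blast
    interpret prime_index_abelian G p A x
      by (rule prime_index_abelian.intro[OF group_axioms prime_index_abelian_axioms.intro])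
        (use p assms(3) A x in simp_all)
    have cardZ: "card (centralizer G (carrier G)) = p"
      by (rule card_center_eq_prime[OF p n na expo assms(6)])
    \<comment> \<open>Otherwise \<open>G\<close> would be no larger than its centre of order
      \<open>p\<close>, hence abelian.\<close>
    have "n \<ge> 2"
    proof (rule ccontr)
      assume "\<not> n \<ge> 2"
      then have "n = 0 \<or> n = 1" by auto
      then have "card (carrier G) \<le> card (centralizer G (carrier G))"
        using n p1 cardZ by (auto simp: order_def)
      moreover have "centralizer G (carrier G) \<subseteq> carrier G" by (auto intro: centralizer_carrier)
      ultimately have "centralizer G (carrier G) = carrier G"
        using card_seteq[OF assms(3)] by blast
      then have "comm_group G"
        by (intro group_comm_groupI) (metis centralizerD)
      then show False using na by simp
    qed
    note max = maximal_class_and_bound[OF expo cardZ n this]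
    \<comment> \<open>In the non-abelian case the order never exceeds \<open>p ^ p\<close>, so the
      first implication holds vacuously and only the second has content.\<close>
    have "p ^ n \<le> p ^ p" using max(2) p1 by (simp add: power_increasing)
    moreover have "elementary_abelian p (G\<lparr>carrier := A\<rparr>)"
      using A(2) expo subgroup.subset[OF sub]
      unfolding elementary_abelian_def by (auto simp flip: nat_pow_consistent)
    ultimately show ?thesis using max(1) n sub A(3) by auto
  qed
qed

end
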